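(* Fix $\varepsilon>0$. Let $(X_n,A,m_n,\alpha_n)_{n\ge1}$ be a family of micro-macro systems (all with the same finite set of macrostates $A$) having large deviations with an injective rate function $I:A\to\mathbb{R}_{\ge0}$, i.e. writing $a_n=m_n^{-1}(a)$, $$\lim_{n\to\infty}\frac1n\ln\Big(\frac{|a_n|}{|X_n|}\Big)=-I(a)\quad\text{for all }a\in A.$$ Then: (a) for $n$ large enough, $(X_n,A,m_n,\alpha_n)$ has an $\varepsilon$-dominant equilibrium, i.e. $|X_n^{\mathrm{eq}}|/|X_n|\ge 1-\varepsilon$; (b) for each $a\in A$, setting $Da_n=\{i\in a_n: S(\alpha_n i)<S(i)\}$, we have $\frac{|Da_n|}{|a_n|}\le\varepsilon$ for $n$ large enough.
   Context: A micro-macro system $(X,A,m,\alpha)$ consists of finite sets $X$ (microstates) and $A$ (macrostates), a bijection $\alpha:X\to X$ and a surjection $m:X\to A$. For a system $(X_n,A,m_n,\alpha_n)$ the entropy of a microstate $i\in X_n$ is $S(i)=\ln|m_n^{-1}(m_n(i))|$. $X_n^{\mathrm{eq}}$ denotes the set of microstates lying in a macrostate $a$ of maximal size $|m_n^{-1}(a)|$. *)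

theory Defs
  imports Complex_Main
begin

locale micro_macro_system =
  fixes X :: "'x set" and A :: "'a set" and m :: "'x \<Rightarrow> 'a" and \<alpha> :: "'x \<Rightarrow> 'x"
  assumes finite_microstates: "finite X"
    and finite_macrostates: "finite A"
    and macro_surj: "m ` X = A"
    and dynamics_bij: "bij_betw \<alpha> X X"

definition macro_fiber :: "'x set \<Rightarrow> ('x \<Rightarrow> 'a) \<Rightarrow> 'a \<Rightarrow> 'x set" where
  "macro_fiber X m a = {i \<in> X. m i = a}"

definition entropy :: "'x set \<Rightarrow> ('x \<Rightarrow> 'a) \<Rightarrow> 'x \<Rightarrow> real" where
  "entropy X m i = ln (real (card (macro_fiber X m (m i))))"

definition equilibrium :: "'x set \<Rightarrow> 'a set \<Rightarrow> ('x \<Rightarrow> 'a) \<Rightarrow> 'x set" where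
  "equilibrium X A m =
    {i \<in> X. \<forall>b\<in>A. card (macro_fiber X m b) \<le> card (macro_fiber X m (m i))}"

definition dominant_equilibrium :: "real \<Rightarrow> 'x set \<Rightarrow> 'a set \<Rightarrow> ('x \<Rightarrow> 'a) \<Rightarrow> bool" where
  "dominant_equilibrium \<epsilon> X A m \<longleftrightarrow>
    real (card (equilibrium X A m)) / real (card X) \<ge> 1 - \<epsilon>"

definition decreasing_set ::
    "'x set \<Rightarrow> ('x \<Rightarrow> 'a) \<Rightarrow> ('x \<Rightarrow> 'x) \<Rightarrow> 'a \<Rightarrow> 'x set" where
  "decreasing_set X m \<alpha> a =
    {i \<in> macro_fiber X m a. entropy X m (\<alpha> i) < entropy X m i}"

definition has_large_deviations ::
    "(nat \<Rightarrow> 'x set) \<Rightarrow> 'a set \<Rightarrow> (nat \<Rightarrow> 'x \<Rightarrow> 'a) \<Rightarrow> ('a \<Rightarrow> real) \<Rightarrow> bool" where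
  "has_large_deviations X A m I \<longleftrightarrow>
    (\<forall>a\<in>A. (\<lambda>n. 1 / real n *
        ln (real (card (macro_fiber (X n) (m n) a)) / real (card (X n))))
      \<longlonglongrightarrow> - I a)"

end

theory Submission
  imports Defs
begin

text \<open>If \<open>I b < I a\<close>, the large deviation limits show that \<open>|a\<^sub>n| / |b\<^sub>n|\<close> decays exponentially, so by
  injectivity of \<open>I\<close> and finiteness of \<open>A\<close> the macrostates are eventually ordered by size as by
  \<open>-I\<close>, each negligible relative to every larger one. The minimiser of \<open>I\<close> then carries almost all
  of \<open>X\<^sub>n\<close>. For the second claim, \<open>\<alpha>\<^sub>n\<close> maps the entropy-decreasing part of \<open>a\<^sub>n\<close> injectively into
  the union of the macrostates smaller than \<open>a\<^sub>n\<close>, whose total size is negligible relative to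
  \<open>|a\<^sub>n|\<close>.\<close>

context micro_macro_system
begin

lemma finite_macro_fiber: "finite (macro_fiber X m a)"
  using finite_microstates by (simp add: macro_fiber_def)

lemma card_macro_fiber_pos: "a \<in> A \<Longrightarrow> card (macro_fiber X m a) > 0"
  using macro_surj finite_macro_fiber by (auto simp: card_gt_0_iff macro_fiber_def)

lemma card_microstates_pos: "A \<noteq> {} \<Longrightarrow> card X > 0"
  using macro_surj finite_microstates by (auto simp: card_gt_0_iff)

text \<open>Union bound over the fibres of \<open>B\<close>. The factor is \<open>card A\<close>
  rather than \<open>card B\<close>, so that one constant serves every set of macrostates and every
  index \<open>n\<close>.\<close>

lemma card_vimage_macrostates_le:
  assumes "B \<subseteq> A" and "C \<ge> 0"
    and "\<And>b. b \<in> B \<Longrightarrow> real (card (macro_fiber X m b)) \<le> C"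
  shows "real (card {i \<in> X. m i \<in> B}) \<le> real (card A) * C"
proof -
  have fin: "finite B"
    using assms(1) finite_macrostates finite_subset by blast
  have eq: "{i \<in> X. m i \<in> B} = (\<Union>b\<in>B. macro_fiber X m b)"
    by (auto simp: macro_fiber_def)
  have "card {i \<in> X. m i \<in> B} \<le> (\<Sum>b\<in>B. card (macro_fiber X m b))"
    unfolding eq by (rule card_UN_le[OF fin])
  hence "real (card {i \<in> X. m i \<in> B}) \<le> (\<Sum>b\<in>B. real (card (macro_fiber X m b)))"
    by (metis of_nat_le_iff of_nat_sum)
  also have "\<dots> \<le> real (card B) * C"
    using sum_bounded_above[of B "\<lambda>b. real (card (macro_fiber X m b))" C] assms(3) by simp
  also have "\<dots> \<le> real (card A) * C"
    using assms(2) card_mono[OF finite_macrostates assms(1)] by (intro mult_right_mono) auto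
  finally show ?thesis .
qed

text \<open>Since \<delta> \<le> 1, the macrostate \<open>a\<close> has maximal size, so its fibre
  lies in the equilibrium; the union bound applied to the other fibres makes the complement of this
  fibre at most an \<epsilon>-fraction of \<open>X\<close>.\<close>

lemma dominant_equilibrium_if_others_small:
  assumes a: "a \<in> A" and "\<delta> \<ge> 0" "\<delta> \<le> 1" and \<epsilon>: "real (card A) * \<delta> \<le> \<epsilon>"
    and small: "\<And>b. b \<in> A \<Longrightarrow> b \<noteq> a \<Longrightarrow>
      real (card (macro_fiber X m b)) \<le> \<delta> * real (card (macro_fiber X m a))"
  shows "dominant_equilibrium \<epsilon> X A m"
proof -
  let ?F = "macro_fiber X m a"
  have sub: "?F \<subseteq> X"
    by (auto simp: macro_fiber_def)
  have Xpos: "card X > 0"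
    using card_microstates_pos a by blast
  have le: "card (macro_fiber X m b) \<le> card ?F" if "b \<in> A" for b
  proof (cases "b = a")
    case False
    have "\<delta> * real (card ?F) \<le> 1 * real (card ?F)"
      using assms(3) by (intro mult_right_mono) auto
    with small[OF that False] show ?thesis by simp
  qed simp
  have "?F \<subseteq> equilibrium X A m"
    using le by (auto simp: equilibrium_def macro_fiber_def)
  moreover have "finite (equilibrium X A m)"
    using finite_microstates by (simp add: equilibrium_def)
  ultimately have eq: "card ?F \<le> card (equilibrium X A m)"
    by (rule card_mono[rotated])
  have compl: "X - ?F = {i \<in> X. m i \<in> A - {a}}"
    using macro_surj by (auto simp: macro_fiber_def)
  have "real (card X) - real (card ?F) = real (card (X - ?F))"
    using card_Diff_subset[OF finite_macro_fiber sub] card_mono[OF finite_microstates sub]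
    by (simp add: of_nat_diff)
  also have "\<dots> \<le> real (card A) * (\<delta> * real (card ?F))"
    unfolding compl using small assms(2) by (intro card_vimage_macrostates_le) auto
  also have "\<dots> = (real (card A) * \<delta>) * real (card ?F)"
    by simp
  \<comment> \<open>Enlarging the fibre to \<open>X\<close> requires \<epsilon> \<ge> 0, which
    follows from 0 \<le> \<open>card A\<close> * \<delta> \<le> \<epsilon>.\<close>
  also have "\<dots> \<le> \<epsilon> * real (card X)"
    using \<epsilon> assms(2) card_mono[OF finite_microstates sub]
    by (intro mult_mono) (auto intro: order_trans[OF _ \<epsilon>])
  finally have "(1 - \<epsilon>) * real (card X) \<le> real (card (equilibrium X A m))"
    using eq by (simp add: algebra_simps)
  thus ?thesis
    using Xpos by (simp add: dominant_equilibrium_def pos_le_divide_eq)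
qed

text \<open>A bijection cannot squeeze many microstates into little room: the union bound limits the
  space available in strictly smaller macrostates, hence the number of points of \<open>a\<close>
  that can move there.\<close>

lemma decreasing_set_fraction_le:
  assumes a: "a \<in> A" and "\<delta> \<ge> 0" and \<epsilon>: "real (card A) * \<delta> \<le> \<epsilon>"
    and small: "\<And>b. b \<in> A \<Longrightarrow> card (macro_fiber X m b) < card (macro_fiber X m a) \<Longrightarrow>
      real (card (macro_fiber X m b)) \<le> \<delta> * real (card (macro_fiber X m a))"
  shows "real (card (decreasing_set X m \<alpha> a)) / real (card (macro_fiber X m a)) \<le> \<epsilon>"
proof -
  let ?c = "\<lambda>b. card (macro_fiber X m b)"
  let ?D = "decreasing_set X m \<alpha> a"
  define B where "B = {b \<in> A. ?c b < ?c a}"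
  have D: "?D \<subseteq> X"
    by (auto simp: decreasing_set_def macro_fiber_def)
  have img: "\<alpha> ` ?D \<subseteq> {i \<in> X. m i \<in> B}"
  proof clarify
    fix i assume i: "i \<in> ?D"
    hence iX: "i \<in> X" and mi: "m i = a" and S: "entropy X m (\<alpha> i) < entropy X m i"
      by (auto simp: decreasing_set_def macro_fiber_def)
    have \<alpha>X: "\<alpha> i \<in> X"
      using dynamics_bij iX by (auto simp: bij_betw_def)
    hence mA: "m (\<alpha> i) \<in> A"
      using macro_surj by blast
    \<comment> \<open>Both fibres are nonempty by surjectivity of \<open>m\<close>, so
      \<open>ln\<close> is compared only at positive arguments, where it is strictly
      monotone.\<close>
    have "?c (m (\<alpha> i)) < ?c a"
      using S card_macro_fiber_pos[OF mA] card_macro_fiber_pos[OF a] by (simp add: entropy_def mi)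
    thus "\<alpha> i \<in> X \<and> m (\<alpha> i) \<in> B"
      using \<alpha>X mA by (simp add: B_def)
  qed
  have "inj_on \<alpha> ?D"
    using dynamics_bij D by (auto simp: bij_betw_def intro: inj_on_subset)
  hence "card ?D \<le> card {i \<in> X. m i \<in> B}"
    using img finite_microstates by (intro card_inj_on_le) auto
  hence "real (card ?D) \<le> real (card {i \<in> X. m i \<in> B})"
    by simp
  also have "\<dots> \<le> real (card A) * (\<delta> * real (?c a))"
    using small assms(2) by (intro card_vimage_macrostates_le) (auto simp: B_def)
  also have "\<dots> = (real (card A) * \<delta>) * real (?c a)"
    by simp
  also have "\<dots> \<le> \<epsilon> * real (?c a)"
    using \<epsilon> by (intro mult_right_mono) auto
  finally show ?thesis
    using card_macro_fiber_pos[OF a] by (simp add: pos_divide_le_eq)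
qed

end

text \<open>The common normalisation \<open>h\<close> cancels in the difference of the two rates, so
  \<open>ln (f n / g n) / n\<close> tends to \<open>u - v < 0\<close> and \<open>f n / g n\<close>
  eventually lies below \<open>exp (- c * n)\<close> for some \<open>c > 0\<close>.\<close>

lemma eventually_le_mult_if_exponential_rate_less:
  fixes f g h :: "nat \<Rightarrow> real"
  assumes f: "(\<lambda>n. 1 / real n * ln (f n / h n)) \<longlonglongrightarrow> u"
    and g: "(\<lambda>n. 1 / real n * ln (g n / h n)) \<longlonglongrightarrow> v"
    and "u < v" and "\<delta> > 0"
    and pos: "\<forall>\<^sub>F n in sequentially. f n > 0 \<and> g n > 0 \<and> h n > 0"
  shows "\<forall>\<^sub>F n in sequentially. f n \<le> \<delta> * g n"
proof -
  \<comment> \<open>Half the gap: the limit \<open>u - v\<close> equals \<open>- 2 * c\<close>,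
    which leaves room for a strict bound by \<open>- c\<close> at all large
    \<open>n\<close>.\<close>
  define c where "c = (v - u) / 2"
  have c: "c > 0" "u - v < - c"
    using \<open>u < v\<close> by (auto simp: c_def field_simps)
  have "\<forall>\<^sub>F n in sequentially. 1 / real n * ln (f n / h n) - 1 / real n * ln (g n / h n) < - c"
    using order_tendstoD(2)[OF tendsto_diff[OF f g] c(2)] .
  \<comment> \<open>From this threshold on, \<open>exp (- c * n)\<close> is at most
    \<delta>.\<close>
  moreover have "\<forall>\<^sub>F n in sequentially. real n \<ge> - ln \<delta> / c"
    using filterlim_real_sequentially by (simp add: filterlim_at_top)
  ultimately show ?thesis
    using pos eventually_gt_at_top[of 0]
  proof eventually_elim
    case (elim n)
    have "1 / real n * (ln (f n) - ln (g n)) < - c"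
      using elim by (simp add: ln_div algebra_simps)
    \<comment> \<open>Multiplying by \<open>n\<close> needs \<open>n > 0\<close>; at
      \<open>n = 0\<close> the factor \<open>1 / real n\<close> has the default value 0.\<close>
    hence "ln (f n) - ln (g n) < - c * real n"
      using elim(4) by (simp add: field_simps)
    also have "\<dots> \<le> ln \<delta>"
      using elim(2) c(1) by (simp add: field_simps)
    finally have "ln (f n) < ln (\<delta> * g n)"
      using elim(3) \<open>\<delta> > 0\<close> by (simp add: ln_mult)
    thus ?case
      using elim(3) \<open>\<delta> > 0\<close> by simp
  qed
qed

theorem theorem5:
  fixes \<epsilon> :: real
    and X :: "nat \<Rightarrow> 'x set" and A :: "'a set"
    and m :: "nat \<Rightarrow> 'x \<Rightarrow> 'a" and \<alpha> :: "nat \<Rightarrow> 'x \<Rightarrow> 'x"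
    and I :: "'a \<Rightarrow> real"
  assumes "\<epsilon> > 0"
    and "A \<noteq> {}"
    and "\<And>n. n \<ge> 1 \<Longrightarrow> micro_macro_system (X n) A (m n) (\<alpha> n)"
    and "\<And>a. a \<in> A \<Longrightarrow> I a \<ge> 0"
    and "inj_on I A"
    and "has_large_deviations X A m I"
  shows "(\<forall>\<^sub>F n in sequentially. dominant_equilibrium \<epsilon> (X n) A (m n)) \<and>
    (\<forall>a\<in>A. \<forall>\<^sub>F n in sequentially.
      real (card (decreasing_set (X n) (m n) (\<alpha> n) a)) /
      real (card (macro_fiber (X n) (m n) a)) \<le> \<epsilon>)"
proof -
  let ?c = "\<lambda>n a. card (macro_fiber (X n) (m n) a)"
  have fin: "finite A"
    using assms(3)[of 1] by (simp add: micro_macro_system_def)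
  have cardA: "card A > 0"
    using fin \<open>A \<noteq> {}\<close> by (simp add: card_gt_0_iff)
  \<comment> \<open>The second argument absorbs the factor \<open>card A\<close> of the union bound;
    the cap at 1 lets a comparison up to \<delta> also decide which fibre is larger.\<close>
  define \<delta> where "\<delta> = min 1 (\<epsilon> / real (card A))"
  have \<delta>: "\<delta> > 0" "\<delta> \<le> 1"
    using \<open>\<epsilon> > 0\<close> cardA by (auto simp: \<delta>_def)
  have "\<delta> \<le> \<epsilon> / real (card A)"
    by (simp add: \<delta>_def)
  hence \<delta>\<epsilon>: "real (card A) * \<delta> \<le> \<epsilon>"
    using cardA by (simp add: pos_le_divide_eq mult.commute)
  have sys: "\<forall>\<^sub>F n in sequentially. micro_macro_system (X n) A (m n) (\<alpha> n)"
    using eventually_ge_at_top[of 1] by eventually_elim (rule assms(3))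
  have "\<forall>\<^sub>F n in sequentially. I b < I a \<longrightarrow> real (?c n a) \<le> \<delta> * real (?c n b)"
    if "a \<in> A" "b \<in> A" for a b
  proof (cases "I b < I a")
    case True
    have "\<forall>\<^sub>F n in sequentially. real (?c n a) > 0 \<and> real (?c n b) > 0 \<and> real (card (X n)) > 0"
      using sys
    proof eventually_elim
      case (elim n)
      then interpret micro_macro_system "X n" A "m n" "\<alpha> n" .
      show ?case
        using card_macro_fiber_pos card_microstates_pos that \<open>A \<noteq> {}\<close> by simp
    qed
    with True that assms(6) \<delta>(1)
    have "\<forall>\<^sub>F n in sequentially. real (?c n a) \<le> \<delta> * real (?c n b)"
      by (intro eventually_le_mult_if_exponential_rate_less
            [where u = "- I a" and v = "- I b" and h = "\<lambda>n. real (card (X n))"])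
         (auto simp: has_large_deviations_def)
    thus ?thesis by eventually_elim simp
  qed simp
  \<comment> \<open>Finiteness of \<open>A\<close> gives a single threshold for all pairs, so below
    each large \<open>n\<close> can be treated as one fixed system.\<close>
  hence sep: "\<forall>\<^sub>F n in sequentially. \<forall>a\<in>A. \<forall>b\<in>A.
      I b < I a \<longrightarrow> real (?c n a) \<le> \<delta> * real (?c n b)"
    using fin by (simp add: eventually_ball_finite)
  obtain a0 where a0: "a0 \<in> A" "\<And>b. b \<in> A \<Longrightarrow> I a0 \<le> I b"
    using ex_min_if_finite[of "I ` A"] fin \<open>A \<noteq> {}\<close> by (force simp: not_less)
  \<comment> \<open>Injectivity makes the minimiser strict, so \<open>sep\<close> applies to every
    other macrostate.\<close>
  have less: "I a0 < I b" if "b \<in> A" "b \<noteq> a0" for b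
    using a0 that \<open>inj_on I A\<close> by (metis inj_onD order_le_less)
  have "\<forall>\<^sub>F n in sequentially. dominant_equilibrium \<epsilon> (X n) A (m n)"
    using sep sys
  proof eventually_elim
    case (elim n)
    then interpret micro_macro_system "X n" A "m n" "\<alpha> n" by simp
    show ?case
      using elim(1) less a0(1) \<delta> \<delta>\<epsilon>
      by (intro dominant_equilibrium_if_others_small[of a0 \<delta>]) auto
  qed
  moreover have "\<forall>\<^sub>F n in sequentially.
      real (card (decreasing_set (X n) (m n) (\<alpha> n) a)) / real (?c n a) \<le> \<epsilon>" if a: "a \<in> A" for a
    using sep sys
  proof eventually_elim
    case (elim n)
    then interpret micro_macro_system "X n" A "m n" "\<alpha> n" by simp
    \<comment> \<open>Size order is turned back into rate order: a smaller rate for \<open>b\<close>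
      would make \<open>b\<close> at least as large as \<open>a\<close>, and equal rates would force
      \<open>a = b\<close>. Hence \<open>I a < I b\<close>, and \<open>sep\<close> applies.\<close>
    have "real (?c n b) \<le> \<delta> * real (?c n a)" if b: "b \<in> A" and lt: "?c n b < ?c n a" for b
    proof -
      have "\<not> I b < I a"
      proof
        assume "I b < I a"
        hence "real (?c n a) \<le> \<delta> * real (?c n b)"
          using elim(1) a b by blast
        also have "\<dots> \<le> 1 * real (?c n b)"
          using \<delta>(2) by (intro mult_right_mono) auto
        finally show False
          using lt by simp
      qed
      moreover have "I b \<noteq> I a"
        using lt a b \<open>inj_on I A\<close> by (metis inj_onD less_irrefl)
      ultimately show ?thesis
        using elim(1) a b by auto
    qed
    thus ?case
      using a \<delta>(1) \<delta>\<epsilon> by (intro decreasing_set_fraction_le[of a \<delta>]) auto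
  qed
  ultimately show ?thesis by blast
qed

end
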